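(* Let $(M,\varphi,\zeta,\eta,\langle\cdot,\cdot\rangle)$ be an almost contact metric manifold. Then the exterior derivative of the one-form $\xi_\zeta\eta$ (which determines the $\mathcal C_{12}$-component of the intrinsic torsion $\xi$) is given, for all vector fields $X,Y$, by $$\begin{aligned} d(\xi_\zeta\eta)(X,Y)={}&((\nabla^{U(n)}_\zeta\xi)_X\eta)(Y)-((\nabla^{U(n)}_\zeta\xi)_Y\eta)(X)+(\xi_X\eta)(\xi_\zeta Y)-(\xi_Y\eta)(\xi_\zeta X)\\ &-(\xi_{\xi_X\zeta}\eta)(Y)+(\xi_{\xi_Y\zeta}\eta)(X)+(\xi_{\xi_\zeta X}\eta)(Y)-(\xi_{\xi_\zeta Y}\eta)(X). \end{aligned}$$
   Context: Almost contact metric manifold: a $(2n+1)$-dimensional smooth manifold $M$ with a $(1,1)$-tensor $\varphi$, a vector field $\zeta$ (Reeb vector field), a one-form $\eta$ and a Riemannian metric $\langle\cdot,\cdot\rangle$ such that $\varphi^2=-I+\eta\otimes\zeta$, $\eta(\zeta)=1$, $\langle\varphi X,\varphi Y\rangle=\langle X,Y\rangle-\eta(X)\eta(Y)$. Then $\varphi\zeta=0$, $\eta\circ\varphi=0$, $\eta=\langle\zeta,\cdot\rangle$. $\nabla$ is the Levi-Civita connection. Convention: $d\alpha(X,Y)=(\nabla_X\alpha)(Y)-(\nabla_Y\alpha)(X)$ for one-forms. Intrinsic torsion: $\xi_X=-\frac12\varphi\circ\nabla_X\varphi+\nabla_X\eta\otimes\zeta-\frac12\eta\otimes\nabla_X\zeta$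 (a skew-symmetric endomorphism for each $X$); $\nabla^{U(n)}=\nabla+\xi$ is the minimal connection, satisfying $\nabla^{U(n)}\varphi=0$, $\nabla^{U(n)}\eta=0$, $\nabla^{U(n)}\langle\cdot,\cdot\rangle=0$. Endomorphisms act on $\eta$ as derivations: $(\xi_X\eta)(Y)=-\eta(\xi_XY)=\langle\xi_X\zeta,Y\rangle$, $((\nabla^{U(n)}_Z\xi)_X\eta)(Y)=-\eta((\nabla^{U(n)}_Z\xi)_XY)$. Thus $\xi_X\eta=-\nabla_X\eta$, and $\xi_\zeta\eta=-\nabla_\zeta\eta$. *)

theory Defs
  imports "HOL-Analysis.Analysis" "HOL-Library.Function_Algebras"
begin

section \<open>Smooth manifolds\<close>

text \<open>A manifold is a whole type \<open>'m\<close> (Hausdorff and second countable by its type classes) together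
  with a smooth atlas \<open>A\<close> modelled on a Euclidean space \<open>'e\<close>.  A chart is a pair of its domain and
  its coordinate map.\<close>

text \<open>\<open>Ck_on k f S\<close> is meant for open \<open>S\<close>: all iterated directional derivatives of order up to \<open>k\<close>
  exist and are continuous on \<open>S\<close>.\<close>

fun Ck_on :: "nat \<Rightarrow> ('a::real_normed_vector \<Rightarrow> 'b::real_normed_vector) \<Rightarrow> 'a set \<Rightarrow> bool" where
  "Ck_on 0 f S \<longleftrightarrow> continuous_on S f"
| "Ck_on (Suc k) f S \<longleftrightarrow>
     (\<forall>x\<in>S. f differentiable (at x)) \<and> (\<forall>v. Ck_on k (\<lambda>x. frechet_derivative f (at x) v) S)"

definition smooth_on :: "('a::real_normed_vector \<Rightarrow> 'b::real_normed_vector) \<Rightarrow> 'a set \<Rightarrow> bool" where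
  "smooth_on f S \<longleftrightarrow> (\<forall>k. Ck_on k f S)"

type_synonym ('m, 'e) atlas = "('m set \<times> ('m \<Rightarrow> 'e)) set"

definition smooth_atlas ::
    "('m::{t2_space, second_countable_topology}, 'e::euclidean_space) atlas \<Rightarrow> bool" where
  "smooth_atlas A \<longleftrightarrow>
     (\<Union>(U, c)\<in>A. U) = UNIV \<and>
     (\<forall>(U, c)\<in>A. open U \<and> open (c ` U) \<and> homeomorphism U (c ` U) c (inv_into U c)) \<and>
     (\<forall>(U, c)\<in>A. \<forall>(V, d)\<in>A. smooth_on (d \<circ> inv_into U c) (c ` (U \<inter> V)))"

definition smooth_functions ::
    "('m::{t2_space, second_countable_topology}, 'e::euclidean_space) atlas \<Rightarrow> ('m \<Rightarrow> real) set" where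
  "smooth_functions A = {f. \<forall>(U, c)\<in>A. smooth_on (f \<circ> inv_into U c) (c ` U)}"

section \<open>Tangent vectors and vector fields\<close>

text \<open>Tangent vectors at \<open>p\<close> are the point derivations at \<open>p\<close> of the algebra of smooth functions.
  They are normalised to vanish on non-smooth functions, so that equality of tangent vectors is
  equality of HOL functions.  Sums, differences and negatives of tangent vectors, of vector fields
  and of functions are the pointwise ones of \<^theory>\<open>HOL-Library.Function_Algebras\<close>.\<close>

type_synonym 'm tvec = "('m \<Rightarrow> real) \<Rightarrow> real"
type_synonym 'm vfield = "'m \<Rightarrow> 'm tvec"

definition tangent_space ::
    "('m::{t2_space, second_countable_topology}, 'e::euclidean_space) atlas \<Rightarrow> 'm \<Rightarrow> 'm tvec set" where
  "tangent_space A p = {v.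
     (\<forall>f\<in>smooth_functions A. \<forall>h\<in>smooth_functions A. v (f + h) = v f + v h) \<and>
     (\<forall>a. \<forall>f\<in>smooth_functions A. v (\<lambda>q. a * f q) = a * v f) \<and>
     (\<forall>f\<in>smooth_functions A. \<forall>h\<in>smooth_functions A. v (f * h) = f p * v h + h p * v f) \<and>
     (\<forall>f. f \<notin> smooth_functions A \<longrightarrow> v f = 0)}"

definition scale_tvec :: "real \<Rightarrow> 'm tvec \<Rightarrow> 'm tvec"  (infixr "*\<^sub>T" 75) where
  "a *\<^sub>T v = (\<lambda>f. a * v f)"

definition scale_vfield :: "('m \<Rightarrow> real) \<Rightarrow> 'm vfield \<Rightarrow> 'm vfield"  (infixr "*\<^sub>V" 75) where
  "h *\<^sub>V X = (\<lambda>p. h p *\<^sub>T X p)"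

definition dir_deriv :: "'m vfield \<Rightarrow> ('m \<Rightarrow> real) \<Rightarrow> 'm \<Rightarrow> real" where
  "dir_deriv X f = (\<lambda>p. X p f)"

definition vector_fields ::
    "('m::{t2_space, second_countable_topology}, 'e::euclidean_space) atlas \<Rightarrow> 'm vfield set" where
  "vector_fields A =
     {X. (\<forall>p. X p \<in> tangent_space A p) \<and> (\<forall>f\<in>smooth_functions A. dir_deriv X f \<in> smooth_functions A)}"

definition lie_bracket :: "'m vfield \<Rightarrow> 'm vfield \<Rightarrow> 'm vfield" where
  "lie_bracket X Y = (\<lambda>p f. X p (dir_deriv Y f) - Y p (dir_deriv X f))"

section \<open>Tensor fields\<close>

text \<open>Tensor fields are families of multilinear maps on the tangent spaces; smoothness means that
  smooth vector fields are mapped to smooth vector fields or functions.  Their values outside the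
  tangent spaces are irrelevant.\<close>

definition endo_app :: "('m \<Rightarrow> 'm tvec \<Rightarrow> 'm tvec) \<Rightarrow> 'm vfield \<Rightarrow> 'm vfield" where
  "endo_app \<phi> X = (\<lambda>p. \<phi> p (X p))"

definition form_app :: "('m \<Rightarrow> 'm tvec \<Rightarrow> real) \<Rightarrow> 'm vfield \<Rightarrow> 'm \<Rightarrow> real" where
  "form_app \<eta> X = (\<lambda>p. \<eta> p (X p))"

definition metric_app :: "('m \<Rightarrow> 'm tvec \<Rightarrow> 'm tvec \<Rightarrow> real) \<Rightarrow> 'm vfield \<Rightarrow> 'm vfield \<Rightarrow> 'm \<Rightarrow> real" where
  "metric_app g X Y = (\<lambda>p. g p (X p) (Y p))"

definition endo_field ::
    "('m::{t2_space, second_countable_topology}, 'e::euclidean_space) atlas \<Rightarrow>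
     ('m \<Rightarrow> 'm tvec \<Rightarrow> 'm tvec) \<Rightarrow> bool" where
  "endo_field A \<phi> \<longleftrightarrow>
     (\<forall>p. \<forall>v\<in>tangent_space A p. \<phi> p v \<in> tangent_space A p) \<and>
     (\<forall>p. \<forall>v\<in>tangent_space A p. \<forall>w\<in>tangent_space A p. \<phi> p (v + w) = \<phi> p v + \<phi> p w) \<and>
     (\<forall>p a. \<forall>v\<in>tangent_space A p. \<phi> p (a *\<^sub>T v) = a *\<^sub>T \<phi> p v) \<and>
     (\<forall>X\<in>vector_fields A. endo_app \<phi> X \<in> vector_fields A)"

definition one_form ::
    "('m::{t2_space, second_countable_topology}, 'e::euclidean_space) atlas \<Rightarrow>
     ('m \<Rightarrow> 'm tvec \<Rightarrow> real) \<Rightarrow> bool" where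
  "one_form A \<eta> \<longleftrightarrow>
     (\<forall>p. \<forall>v\<in>tangent_space A p. \<forall>w\<in>tangent_space A p. \<eta> p (v + w) = \<eta> p v + \<eta> p w) \<and>
     (\<forall>p a. \<forall>v\<in>tangent_space A p. \<eta> p (a *\<^sub>T v) = a * \<eta> p v) \<and>
     (\<forall>X\<in>vector_fields A. form_app \<eta> X \<in> smooth_functions A)"

definition riemannian_metric ::
    "('m::{t2_space, second_countable_topology}, 'e::euclidean_space) atlas \<Rightarrow>
     ('m \<Rightarrow> 'm tvec \<Rightarrow> 'm tvec \<Rightarrow> real) \<Rightarrow> bool" where
  "riemannian_metric A g \<longleftrightarrow>
     (\<forall>p. \<forall>u\<in>tangent_space A p. \<forall>v\<in>tangent_space A p. \<forall>w\<in>tangent_space A p.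
        g p (u + v) w = g p u w + g p v w) \<and>
     (\<forall>p a. \<forall>v\<in>tangent_space A p. \<forall>w\<in>tangent_space A p. g p (a *\<^sub>T v) w = a * g p v w) \<and>
     (\<forall>p. \<forall>v\<in>tangent_space A p. \<forall>w\<in>tangent_space A p. g p v w = g p w v) \<and>
     (\<forall>p. \<forall>v\<in>tangent_space A p. v \<noteq> 0 \<longrightarrow> g p v v > 0) \<and>
     (\<forall>X\<in>vector_fields A. \<forall>Y\<in>vector_fields A. metric_app g X Y \<in> smooth_functions A)"

section \<open>Almost contact metric manifolds\<close>

definition almost_contact_metric_manifold ::
    "nat \<Rightarrow> ('m::{t2_space, second_countable_topology}, 'e::euclidean_space) atlas \<Rightarrow>
     ('m \<Rightarrow> 'm tvec \<Rightarrow> 'm tvec) \<Rightarrow> 'm vfield \<Rightarrow> ('m \<Rightarrow> 'm tvec \<Rightarrow> real) \<Rightarrow>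
     ('m \<Rightarrow> 'm tvec \<Rightarrow> 'm tvec \<Rightarrow> real) \<Rightarrow> bool" where
  "almost_contact_metric_manifold n (A :: ('m, 'e) atlas) \<phi> \<zeta> \<eta> g \<longleftrightarrow>
     DIM('e) = 2 * n + 1 \<and> smooth_atlas A \<and>
     endo_field A \<phi> \<and> \<zeta> \<in> vector_fields A \<and> one_form A \<eta> \<and> riemannian_metric A g \<and>
     (\<forall>p. \<forall>v\<in>tangent_space A p. \<phi> p (\<phi> p v) = - v + \<eta> p v *\<^sub>T \<zeta> p) \<and>
     (\<forall>p. \<eta> p (\<zeta> p) = 1) \<and>
     (\<forall>p. \<forall>v\<in>tangent_space A p. \<forall>w\<in>tangent_space A p.
        g p (\<phi> p v) (\<phi> p w) = g p v w - \<eta> p v * \<eta> p w)"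

section \<open>Connections\<close>

text \<open>A connection \<open>D\<close> maps \<open>X\<close> and \<open>Y\<close> to the covariant derivative of \<open>Y\<close> along \<open>X\<close>; only its
  values on smooth vector fields matter.\<close>

definition affine_connection ::
    "('m::{t2_space, second_countable_topology}, 'e::euclidean_space) atlas \<Rightarrow>
     ('m vfield \<Rightarrow> 'm vfield \<Rightarrow> 'm vfield) \<Rightarrow> bool" where
  "affine_connection A D \<longleftrightarrow>
     (\<forall>X\<in>vector_fields A. \<forall>Y\<in>vector_fields A. D X Y \<in> vector_fields A) \<and>
     (\<forall>X\<in>vector_fields A. \<forall>Y\<in>vector_fields A. \<forall>Z\<in>vector_fields A. D (X + Y) Z = D X Z + D Y Z) \<and>
     (\<forall>X\<in>vector_fields A. \<forall>Y\<in>vector_fields A. \<forall>Z\<in>vector_fields A. D X (Y + Z) = D X Y + D X Z) \<and>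
     (\<forall>f\<in>smooth_functions A. \<forall>X\<in>vector_fields A. \<forall>Y\<in>vector_fields A.
        D (f *\<^sub>V X) Y = f *\<^sub>V D X Y) \<and>
     (\<forall>f\<in>smooth_functions A. \<forall>X\<in>vector_fields A. \<forall>Y\<in>vector_fields A.
        D X (f *\<^sub>V Y) = dir_deriv X f *\<^sub>V Y + f *\<^sub>V D X Y)"

definition levi_civita_connection ::
    "('m::{t2_space, second_countable_topology}, 'e::euclidean_space) atlas \<Rightarrow>
     ('m \<Rightarrow> 'm tvec \<Rightarrow> 'm tvec \<Rightarrow> real) \<Rightarrow> ('m vfield \<Rightarrow> 'm vfield \<Rightarrow> 'm vfield) \<Rightarrow> bool" where
  "levi_civita_connection A g D \<longleftrightarrow>
     affine_connection A D \<and>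
     (\<forall>X\<in>vector_fields A. \<forall>Y\<in>vector_fields A. D X Y - D Y X = lie_bracket X Y) \<and>
     (\<forall>X\<in>vector_fields A. \<forall>Y\<in>vector_fields A. \<forall>Z\<in>vector_fields A.
        dir_deriv X (metric_app g Y Z) = metric_app g (D X Y) Z + metric_app g Y (D X Z))"

text \<open>Covariant derivatives of endomorphisms, one-forms, and endomorphism-valued one-forms, all given
  by their action on vector fields: \<open>T X Y\<close> is the endomorphism \<open>T\<^sub>X\<close> applied to \<open>Y\<close>.\<close>

definition cov_endo ::
    "('m vfield \<Rightarrow> 'm vfield \<Rightarrow> 'm vfield) \<Rightarrow> 'm vfield \<Rightarrow> ('m vfield \<Rightarrow> 'm vfield) \<Rightarrow>
     'm vfield \<Rightarrow> 'm vfield" where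
  "cov_endo D Z E = (\<lambda>Y. D Z (E Y) - E (D Z Y))"

definition cov_form ::
    "('m vfield \<Rightarrow> 'm vfield \<Rightarrow> 'm vfield) \<Rightarrow> 'm vfield \<Rightarrow> ('m vfield \<Rightarrow> 'm \<Rightarrow> real) \<Rightarrow>
     'm vfield \<Rightarrow> 'm \<Rightarrow> real" where
  "cov_form D Z \<alpha> = (\<lambda>Y. dir_deriv Z (\<alpha> Y) - \<alpha> (D Z Y))"

definition cov_endo_form ::
    "('m vfield \<Rightarrow> 'm vfield \<Rightarrow> 'm vfield) \<Rightarrow> 'm vfield \<Rightarrow>
     ('m vfield \<Rightarrow> 'm vfield \<Rightarrow> 'm vfield) \<Rightarrow> 'm vfield \<Rightarrow> 'm vfield \<Rightarrow> 'm vfield" where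
  "cov_endo_form D Z T = (\<lambda>X Y. D Z (T X Y) - T (D Z X) Y - T X (D Z Y))"

text \<open>The exterior derivative in the convention without the factor 1/2, written through a
  torsion-free connection \<open>D\<close>.\<close>

definition ext_deriv ::
    "('m vfield \<Rightarrow> 'm vfield \<Rightarrow> 'm vfield) \<Rightarrow> ('m vfield \<Rightarrow> 'm \<Rightarrow> real) \<Rightarrow>
     'm vfield \<Rightarrow> 'm vfield \<Rightarrow> 'm \<Rightarrow> real" where
  "ext_deriv D \<alpha> X Y = cov_form D X \<alpha> Y - cov_form D Y \<alpha> X"

definition endo_act :: "('m vfield \<Rightarrow> 'm vfield) \<Rightarrow> ('m vfield \<Rightarrow> 'm \<Rightarrow> real) \<Rightarrow> 'm vfield \<Rightarrow> 'm \<Rightarrow> real" where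
  "endo_act E \<alpha> = (\<lambda>Y. - \<alpha> (E Y))"

section \<open>Intrinsic torsion and the minimal connection\<close>

text \<open>In the defining formula \<open>\<beta> \<otimes> Z\<close> is the endomorphism sending \<open>Y\<close> to \<open>\<beta>(Y) Z\<close>.\<close>

definition intrinsic_torsion ::
    "('m vfield \<Rightarrow> 'm vfield \<Rightarrow> 'm vfield) \<Rightarrow> ('m \<Rightarrow> 'm tvec \<Rightarrow> 'm tvec) \<Rightarrow> 'm vfield \<Rightarrow>
     ('m \<Rightarrow> 'm tvec \<Rightarrow> real) \<Rightarrow> 'm vfield \<Rightarrow> 'm vfield \<Rightarrow> 'm vfield" where
  "intrinsic_torsion D \<phi> \<zeta> \<eta> X Y =
     - ((\<lambda>_. 1 / 2) *\<^sub>V endo_app \<phi> (cov_endo D X (endo_app \<phi>) Y))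
     + cov_form D X (form_app \<eta>) Y *\<^sub>V \<zeta>
     - (\<lambda>_. 1 / 2) *\<^sub>V form_app \<eta> Y *\<^sub>V D X \<zeta>"

definition minimal_connection ::
    "('m vfield \<Rightarrow> 'm vfield \<Rightarrow> 'm vfield) \<Rightarrow> ('m \<Rightarrow> 'm tvec \<Rightarrow> 'm tvec) \<Rightarrow> 'm vfield \<Rightarrow>
     ('m \<Rightarrow> 'm tvec \<Rightarrow> real) \<Rightarrow> 'm vfield \<Rightarrow> 'm vfield \<Rightarrow> 'm vfield" where
  "minimal_connection D \<phi> \<zeta> \<eta> X Y = D X Y + intrinsic_torsion D \<phi> \<zeta> \<eta> X Y"

end

theory Submission
  imports Defs
begin

text \<open>Write \<open>D\<close> for the Levi-Civita connection and \<open>U = D + \<xi>\<close> for the minimal connection.  The formula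
  is Cartan's identity \<open>d L\<^sub>\<zeta> \<eta> = L\<^sub>\<zeta> d\<eta>\<close>, with the Lie derivative on the right expressed through \<open>U\<close>.

  The metric gives \<open>\<eta> = g(\<zeta>, \<cdot>)\<close> and \<open>\<eta>(D\<^sub>X \<zeta>) = 0\<close>, the latter because \<open>\<zeta>\<close> has unit length.  Hence the
  defining formula of \<open>\<xi>\<close> collapses to \<open>\<eta>(\<xi>\<^sub>X Y) = (D\<^sub>X \<eta>)(Y)\<close> (\<open>eta_torsion\<close>) and
  \<open>\<xi>\<^sub>X \<zeta> = - D\<^sub>X \<zeta>\<close> (\<open>torsion_reeb\<close>), and since \<open>[\<zeta>, Y] = D\<^sub>\<zeta> Y - D\<^sub>Y \<zeta>\<close>, the form \<open>\<xi>\<^sub>\<zeta> \<eta>\<close> equals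
  \<open>- D\<^sub>\<zeta> \<eta> = - L\<^sub>\<zeta> \<eta>\<close>.  Cartan's identity (\<open>lie_form_ext_deriv_commute\<close>, which comes down to the Jacobi
  identity) therefore gives \<open>d(\<xi>\<^sub>\<zeta> \<eta>) = - L\<^sub>\<zeta> d\<eta>\<close>, where \<open>d\<eta>(X, Y) = (D\<^sub>X \<eta>)(Y) - (D\<^sub>Y \<eta>)(X)\<close>.

  It remains to compare \<open>L\<^sub>\<zeta>\<close> with \<open>U\<^sub>\<zeta>\<close>.  As \<open>U \<eta> = 0\<close>, the derivative of \<open>\<eta>(\<xi>\<^sub>X Y)\<close> along \<open>\<zeta>\<close> is governed
  by \<open>U\<^sub>\<zeta> \<xi>\<close>, and \<open>U\<^sub>\<zeta> X - [\<zeta>, X] = D\<^sub>X \<zeta> + \<xi>\<^sub>\<zeta> X = - \<xi>\<^sub>X \<zeta> + \<xi>\<^sub>\<zeta> X\<close>.  Inserting this difference in both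
  arguments produces the quadratic terms of the formula and the two further terms
  \<open>(\<xi>\<^sub>Y \<eta>)(\<xi>\<^sub>X \<zeta>) - (\<xi>\<^sub>X \<eta>)(\<xi>\<^sub>Y \<zeta>)\<close>.  These cancel because \<open>(D\<^sub>X \<eta>)(D\<^sub>Y \<zeta>) = g(D\<^sub>X \<zeta>, D\<^sub>Y \<zeta>)\<close> is symmetric
  in \<open>X\<close> and \<open>Y\<close>.\<close>

section \<open>The algebra of smooth functions\<close>

text \<open>Openness of \<open>S\<close> makes the derivatives at its points depend only on the values on \<open>S\<close>.  This is
  what lets the sum and product rules, valid only on \<open>S\<close>, be used under iterated differentiation.\<close>

lemma Ck_on_cong:
  assumes "open S" "\<And>x. x \<in> S \<Longrightarrow> f x = h x" "Ck_on k f S"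
  shows "Ck_on k h S"
  using assms(2,3)
proof (induction k arbitrary: f h)
  case 0
  then show ?case by (simp cong: continuous_on_cong)
next
  case (Suc k)
  have der: "(h has_derivative frechet_derivative f (at x)) (at x)" if "x \<in> S" for x
    using Suc.prems that assms(1) frechet_derivative_works
    by (metis Ck_on.simps(2) has_derivative_transform_within_open)
  have "Ck_on k (\<lambda>x. frechet_derivative h (at x) v) S" for v
  proof (rule Suc.IH)
    show "frechet_derivative f (at x) v = frechet_derivative h (at x) v" if "x \<in> S" for x
      using frechet_derivative_at[OF der[OF that]] by simp
    show "Ck_on k (\<lambda>x. frechet_derivative f (at x) v) S"
      using Suc.prems by simp
  qed
  then show ?case using der by (auto simp: differentiable_def)
qed

text \<open>In the product rule each factor also occurs undifferentiated, so the induction for products has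
  to lower the order of differentiability.\<close>

lemma Ck_on_Suc_imp: "Ck_on (Suc k) f S \<Longrightarrow> Ck_on k f S"
proof (induction k arbitrary: f)
  case 0
  then show ?case
    by (auto intro!: differentiable_imp_continuous_on differentiable_at_imp_differentiable_on)
next
  case (Suc k)
  have "f differentiable at x" if "x \<in> S" for x
    using Suc.prems that by simp
  moreover have "Ck_on k (\<lambda>x. frechet_derivative f (at x) v) S" for v
    using Suc.prems by (intro Suc.IH) simp
  ultimately show ?case by simp
qed

lemma Ck_on_const: "Ck_on k (\<lambda>x. c) S"
  by (induction k arbitrary: c) auto

lemma Ck_on_add:
  assumes "open S" "Ck_on k f S" "Ck_on k h S"
  shows "Ck_on k (\<lambda>x. f x + h x) S"
  using assms(2,3)
proof (induction k arbitrary: f h)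
  case 0
  then show ?case by (simp add: continuous_on_add)
next
  case (Suc k)
  have der: "((\<lambda>x. f x + h x) has_derivative
      (\<lambda>v. frechet_derivative f (at x) v + frechet_derivative h (at x) v)) (at x)"
    if "x \<in> S" for x
    using Suc.prems that by (intro has_derivative_add) (auto simp: frechet_derivative_works)
  have "Ck_on k (\<lambda>x. frechet_derivative (\<lambda>x. f x + h x) (at x) v) S" for v
  proof (rule Ck_on_cong[OF assms(1)])
    show "frechet_derivative f (at x) v + frechet_derivative h (at x) v
        = frechet_derivative (\<lambda>x. f x + h x) (at x) v" if "x \<in> S" for x
      using frechet_derivative_at[OF der[OF that]] by metis
    show "Ck_on k (\<lambda>x. frechet_derivative f (at x) v + frechet_derivative h (at x) v) S"
      using Suc.prems by (intro Suc.IH) auto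
  qed
  then show ?case using der by (auto simp: differentiable_def)
qed

lemma Ck_on_mult:
  fixes f h :: "'a::real_normed_vector \<Rightarrow> 'b::real_normed_algebra"
  assumes "open S" "Ck_on k f S" "Ck_on k h S"
  shows "Ck_on k (\<lambda>x. f x * h x) S"
  using assms(2,3)
proof (induction k arbitrary: f h)
  case 0
  then show ?case by (simp add: continuous_on_mult)
next
  case (Suc k)
  have der: "((\<lambda>x. f x * h x) has_derivative
      (\<lambda>v. f x * frechet_derivative h (at x) v + frechet_derivative f (at x) v * h x)) (at x)"
    if "x \<in> S" for x
    using Suc.prems that by (intro has_derivative_mult) (auto simp: frechet_derivative_works)
  have "Ck_on k (\<lambda>x. frechet_derivative (\<lambda>x. f x * h x) (at x) v) S" for v
  proof (rule Ck_on_cong[OF assms(1)])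
    show "f x * frechet_derivative h (at x) v + frechet_derivative f (at x) v * h x
        = frechet_derivative (\<lambda>x. f x * h x) (at x) v" if "x \<in> S" for x
      using frechet_derivative_at[OF der[OF that]] by metis
    show "Ck_on k (\<lambda>x. f x * frechet_derivative h (at x) v + frechet_derivative f (at x) v * h x) S"
      using Suc.prems Suc.prems[THEN Ck_on_Suc_imp] by (intro Ck_on_add assms(1) Suc.IH) auto
  qed
  then show ?case using der by (auto simp: differentiable_def)
qed

lemma chart_range_open: "smooth_atlas A \<Longrightarrow> (U, c) \<in> A \<Longrightarrow> open (c ` U)"
  unfolding smooth_atlas_def by blast

lemma smooth_functions_add:
  assumes "smooth_atlas A" "f \<in> smooth_functions A" "h \<in> smooth_functions A"
  shows "f + h \<in> smooth_functions A"
  using assms by (auto simp: smooth_functions_def smooth_on_def o_def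
      intro!: Ck_on_add dest: chart_range_open[OF assms(1)])

lemma smooth_functions_mult:
  assumes "smooth_atlas A" "f \<in> smooth_functions A" "h \<in> smooth_functions A"
  shows "f * h \<in> smooth_functions A"
  using assms by (auto simp: smooth_functions_def smooth_on_def o_def
      intro!: Ck_on_mult dest: chart_range_open[OF assms(1)])

lemma smooth_functions_const: "(\<lambda>_. a) \<in> smooth_functions A"
  by (auto simp: smooth_functions_def smooth_on_def o_def intro: Ck_on_const)

lemma smooth_functions_diff:
  assumes "smooth_atlas A" "f \<in> smooth_functions A" "h \<in> smooth_functions A"
  shows "f - h \<in> smooth_functions A"
proof -
  have "f - h = f + (\<lambda>_. - 1) * h" by (auto simp: fun_eq_iff)
  moreover have "f + (\<lambda>_. - 1) * h \<in> smooth_functions A"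
    using assms by (intro smooth_functions_add smooth_functions_mult smooth_functions_const)
  ultimately show ?thesis by metis
qed

section \<open>The Lie algebra of vector fields\<close>

lemma vector_fields_add:
  assumes "smooth_atlas A" "X \<in> vector_fields A" "Y \<in> vector_fields A"
  shows "X + Y \<in> vector_fields A"
proof -
  have "(X + Y) p \<in> tangent_space A p" for p
    using assms(2,3) by (auto simp: vector_fields_def tangent_space_def algebra_simps)
  moreover have "dir_deriv (X + Y) f = dir_deriv X f + dir_deriv Y f" for f
    by (auto simp: dir_deriv_def fun_eq_iff)
  ultimately show ?thesis
    using assms by (auto simp: vector_fields_def intro: smooth_functions_add)
qed

lemma scale_tvec_tangent:
  "v \<in> tangent_space A p \<Longrightarrow> a *\<^sub>T v \<in> tangent_space A p"
  by (auto simp: tangent_space_def scale_tvec_def algebra_simps)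

lemma vector_fields_scale:
  assumes "smooth_atlas A" "f \<in> smooth_functions A" "X \<in> vector_fields A"
  shows "f *\<^sub>V X \<in> vector_fields A"
proof -
  have "(f *\<^sub>V X) p \<in> tangent_space A p" for p
    using assms(3) by (simp add: vector_fields_def scale_vfield_def scale_tvec_tangent)
  moreover have "dir_deriv (f *\<^sub>V X) h = f * dir_deriv X h" for h
    by (auto simp: dir_deriv_def scale_vfield_def scale_tvec_def)
  ultimately show ?thesis
    using assms by (auto simp: vector_fields_def intro: smooth_functions_mult)
qed

lemma uminus_vfield_eq: "- X = (\<lambda>_. - 1) *\<^sub>V X" for X :: "'m vfield"
  by (simp add: fun_eq_iff scale_vfield_def scale_tvec_def)

lemma vector_fields_uminus:
  "smooth_atlas A \<Longrightarrow> X \<in> vector_fields A \<Longrightarrow> - X \<in> vector_fields A"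
  by (simp add: uminus_vfield_eq vector_fields_scale smooth_functions_const)

lemma vector_fields_diff:
  "smooth_atlas A \<Longrightarrow> X \<in> vector_fields A \<Longrightarrow> Y \<in> vector_fields A \<Longrightarrow> X - Y \<in> vector_fields A"
  using vector_fields_add[of A X "- Y"] vector_fields_uminus[of A Y] by simp

lemma dir_deriv_smooth:
  "X \<in> vector_fields A \<Longrightarrow> f \<in> smooth_functions A \<Longrightarrow> dir_deriv X f \<in> smooth_functions A"
  by (simp add: vector_fields_def)

lemma dir_deriv_nonsmooth:
  "X \<in> vector_fields A \<Longrightarrow> f \<notin> smooth_functions A \<Longrightarrow> dir_deriv X f = 0"
  by (simp add: vector_fields_def tangent_space_def dir_deriv_def fun_eq_iff)

lemma dir_deriv_add:
  "X \<in> vector_fields A \<Longrightarrow> f \<in> smooth_functions A \<Longrightarrow> h \<in> smooth_functions A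
    \<Longrightarrow> dir_deriv X (f + h) = dir_deriv X f + dir_deriv X h"
  by (simp add: vector_fields_def tangent_space_def dir_deriv_def fun_eq_iff)

lemma dir_deriv_mult:
  "X \<in> vector_fields A \<Longrightarrow> f \<in> smooth_functions A \<Longrightarrow> h \<in> smooth_functions A
    \<Longrightarrow> dir_deriv X (f * h) = f * dir_deriv X h + h * dir_deriv X f"
  by (simp add: vector_fields_def tangent_space_def dir_deriv_def fun_eq_iff)

lemma dir_deriv_cmult:
  "X \<in> vector_fields A \<Longrightarrow> f \<in> smooth_functions A
    \<Longrightarrow> dir_deriv X (\<lambda>q. a * f q) = (\<lambda>q. a * dir_deriv X f q)"
  by (simp add: vector_fields_def tangent_space_def dir_deriv_def fun_eq_iff)

lemma dir_deriv_diff: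
  assumes "smooth_atlas A" "X \<in> vector_fields A" "f \<in> smooth_functions A" "h \<in> smooth_functions A"
  shows "dir_deriv X (f - h) = dir_deriv X f - dir_deriv X h"
proof -
  have "dir_deriv X ((f - h) + h) = dir_deriv X (f - h) + dir_deriv X h"
    using assms by (intro dir_deriv_add smooth_functions_diff)
  then show ?thesis by (simp add: algebra_simps)
qed

lemma dir_deriv_zero: "X \<in> vector_fields A \<Longrightarrow> dir_deriv X 0 = 0"
  using dir_deriv_cmult[of X A 0 0] smooth_functions_const[of 0 A]
  by (simp add: fun_eq_iff zero_fun_def)

lemma dir_deriv_one:
  assumes "X \<in> vector_fields A" shows "dir_deriv X 1 = 0"
proof -
  have "(1 :: _ \<Rightarrow> real) \<in> smooth_functions A"
    using smooth_functions_const[of 1 A] by (simp add: one_fun_def)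
  from dir_deriv_mult[OF assms this this] show ?thesis by simp
qed

lemma dir_deriv_lie_bracket:
  "dir_deriv (lie_bracket X Y) f = dir_deriv X (dir_deriv Y f) - dir_deriv Y (dir_deriv X f)"
  by (simp add: dir_deriv_def lie_bracket_def fun_eq_iff)

lemma vfield_eqI: "(\<And>f. dir_deriv X f = dir_deriv Y f) \<Longrightarrow> X = Y"
  by (auto simp: dir_deriv_def fun_eq_iff)

lemma vector_fields_lie_bracket:
  assumes A: "smooth_atlas A" and X: "X \<in> vector_fields A" and Y: "Y \<in> vector_fields A"
  shows "lie_bracket X Y \<in> vector_fields A"
proof -
  let ?L = "\<lambda>f. dir_deriv (lie_bracket X Y) f"
  note sm = dir_deriv_smooth[OF X] dir_deriv_smooth[OF Y] smooth_functions_add[OF A]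
    smooth_functions_mult[OF A]
  have add: "?L (f + h) = ?L f + ?L h"
    if "f \<in> smooth_functions A" "h \<in> smooth_functions A" for f h
    using that by (simp add: dir_deriv_lie_bracket dir_deriv_add[OF X] dir_deriv_add[OF Y] sm)
  have cmult: "?L (\<lambda>q. a * f q) = (\<lambda>q. a * ?L f q)"
    if "f \<in> smooth_functions A" for a f
    using that by (simp add: dir_deriv_lie_bracket dir_deriv_cmult[OF X] dir_deriv_cmult[OF Y] sm
        fun_eq_iff algebra_simps)
  have mult: "?L (f * h) = f * ?L h + h * ?L f"
    if "f \<in> smooth_functions A" "h \<in> smooth_functions A" for f h
    using that by (simp add: dir_deriv_lie_bracket dir_deriv_add[OF X] dir_deriv_add[OF Y]
        dir_deriv_mult[OF X] dir_deriv_mult[OF Y] sm algebra_simps)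
  \<comment> \<open>Tangent vectors are normalised to vanish on non-smooth functions, so this is part of tangency.\<close>
  have ns: "?L f = 0" if "f \<notin> smooth_functions A" for f
    using that by (simp add: dir_deriv_lie_bracket dir_deriv_nonsmooth[OF X]
        dir_deriv_nonsmooth[OF Y] dir_deriv_zero[OF X] dir_deriv_zero[OF Y])
  have "lie_bracket X Y p \<in> tangent_space A p" for p
    using add cmult mult ns by (simp add: tangent_space_def dir_deriv_def fun_eq_iff)
  then show ?thesis
    using A X Y by (auto simp: vector_fields_def dir_deriv_lie_bracket intro: smooth_functions_diff)
qed

text \<open>This form of the Jacobi identity says that \<open>[Z, \<cdot>]\<close> is a derivation of the bracket.  On a smooth
  function it is the associativity of composing operators; every other function is killed by all
  vector fields.\<close>

lemma lie_bracket_jacobi: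
  assumes A: "smooth_atlas A"
    and X: "X \<in> vector_fields A" and Y: "Y \<in> vector_fields A" and Z: "Z \<in> vector_fields A"
  shows "lie_bracket Z (lie_bracket X Y)
       = lie_bracket (lie_bracket Z X) Y + lie_bracket X (lie_bracket Z Y)"
proof (rule vfield_eqI)
  fix f
  have plus: "dir_deriv (V + W) f = dir_deriv V f + dir_deriv W f" for V W :: "'a vfield"
    by (simp add: dir_deriv_def fun_eq_iff)
  note sm = dir_deriv_smooth[OF X] dir_deriv_smooth[OF Y] dir_deriv_smooth[OF Z]
  note dd = dir_deriv_diff[OF A X] dir_deriv_diff[OF A Y] dir_deriv_diff[OF A Z]
  show "dir_deriv (lie_bracket Z (lie_bracket X Y)) f
      = dir_deriv (lie_bracket (lie_bracket Z X) Y + lie_bracket X (lie_bracket Z Y)) f"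
  proof (cases "f \<in> smooth_functions A")
    case True
    then show ?thesis by (simp add: plus dir_deriv_lie_bracket dd sm algebra_simps)
  next
    case False
    then show ?thesis
      by (simp add: plus dir_deriv_lie_bracket dir_deriv_nonsmooth[OF X] dir_deriv_nonsmooth[OF Y]
          dir_deriv_nonsmooth[OF Z] dir_deriv_zero[OF X] dir_deriv_zero[OF Y] dir_deriv_zero[OF Z])
  qed
qed

section \<open>Cartan calculus\<close>

definition lie_form ::
  "'m vfield \<Rightarrow> ('m vfield \<Rightarrow> 'm \<Rightarrow> real) \<Rightarrow> 'm vfield \<Rightarrow> 'm \<Rightarrow> real" where
  "lie_form Z \<alpha> Y = dir_deriv Z (\<alpha> Y) - \<alpha> (lie_bracket Z Y)"

definition lie_two_form ::
  "'m vfield \<Rightarrow> ('m vfield \<Rightarrow> 'm vfield \<Rightarrow> 'm \<Rightarrow> real) \<Rightarrow> 'm vfield \<Rightarrow> 'm vfield \<Rightarrow> 'm \<Rightarrow> real" where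
  "lie_two_form Z \<omega> X Y =
     dir_deriv Z (\<omega> X Y) - \<omega> (lie_bracket Z X) Y - \<omega> X (lie_bracket Z Y)"

lemma form_app_add:
  "one_form A \<eta> \<Longrightarrow> X \<in> vector_fields A \<Longrightarrow> Y \<in> vector_fields A
    \<Longrightarrow> form_app \<eta> (X + Y) = form_app \<eta> X + form_app \<eta> Y"
  by (simp add: one_form_def form_app_def vector_fields_def fun_eq_iff)

lemma form_app_scale:
  "one_form A \<eta> \<Longrightarrow> X \<in> vector_fields A \<Longrightarrow> form_app \<eta> (f *\<^sub>V X) = f * form_app \<eta> X"
  by (simp add: one_form_def form_app_def vector_fields_def scale_vfield_def fun_eq_iff)

lemma form_app_uminus:
  "one_form A \<eta> \<Longrightarrow> X \<in> vector_fields A \<Longrightarrow> form_app \<eta> (- X) = - form_app \<eta> X"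
  by (simp add: uminus_vfield_eq form_app_scale fun_eq_iff)

lemma form_app_diff:
  assumes "smooth_atlas A" "one_form A \<eta>" "X \<in> vector_fields A" "Y \<in> vector_fields A"
  shows "form_app \<eta> (X - Y) = form_app \<eta> X - form_app \<eta> Y"
  using form_app_add[OF assms(2,3) vector_fields_uminus[OF assms(1,4)]]
    form_app_uminus[OF assms(2,4)] by simp

lemma form_app_smooth:
  "one_form A \<eta> \<Longrightarrow> X \<in> vector_fields A \<Longrightarrow> form_app \<eta> X \<in> smooth_functions A"
  by (simp add: one_form_def)

text \<open>Torsion-freeness turns \<open>\<alpha>(D\<^sub>X Y) - \<alpha>(D\<^sub>Y X)\<close> into \<open>\<alpha>([X, Y])\<close>, so the exterior derivative does not
  depend on the connection.  Here \<open>\<alpha>\<close> is a map on vector fields and not a pointwise one-form, because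
  the lemma is applied to \<open>\<xi>\<^sub>\<zeta> \<eta>\<close>, which is given in this way.\<close>

lemma ext_deriv_torsion_free:
  assumes "affine_connection A D"
    and "\<And>X Y. X \<in> vector_fields A \<Longrightarrow> Y \<in> vector_fields A \<Longrightarrow> D X Y - D Y X = lie_bracket X Y"
    and "\<And>X Y. X \<in> vector_fields A \<Longrightarrow> Y \<in> vector_fields A \<Longrightarrow> \<alpha> (X - Y) = \<alpha> X - \<alpha> Y"
    and "X \<in> vector_fields A" "Y \<in> vector_fields A"
  shows "ext_deriv D \<alpha> X Y = dir_deriv X (\<alpha> Y) - dir_deriv Y (\<alpha> X) - \<alpha> (lie_bracket X Y)"
proof -
  have "D X Y \<in> vector_fields A" "D Y X \<in> vector_fields A"
    using assms(1,4,5) by (auto simp: affine_connection_def)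
  then have "\<alpha> (lie_bracket X Y) = \<alpha> (D X Y) - \<alpha> (D Y X)"
    using assms(3)[of "D X Y" "D Y X"] assms(2,4,5) by simp
  then show ?thesis by (simp add: ext_deriv_def cov_form_def)
qed

text \<open>Cartan's identity \<open>d L\<^sub>Z \<eta> = L\<^sub>Z d\<eta>\<close>, the left side being the invariant formula for \<open>d\<close>.  Second
  derivatives of \<open>\<eta>(X)\<close> and \<open>\<eta>(Y)\<close> match by the definition of the bracket, and the terms with two
  nested brackets match by the Jacobi identity.\<close>

lemma lie_form_ext_deriv_commute:
  assumes A: "smooth_atlas A" and \<eta>: "one_form A \<eta>"
    and X: "X \<in> vector_fields A" and Y: "Y \<in> vector_fields A" and Z: "Z \<in> vector_fields A"
    and D: "affine_connection A D"
      "\<And>X Y. X \<in> vector_fields A \<Longrightarrow> Y \<in> vector_fields A \<Longrightarrow> D X Y - D Y X = lie_bracket X Y"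
  shows "dir_deriv X (lie_form Z (form_app \<eta>) Y) - dir_deriv Y (lie_form Z (form_app \<eta>) X)
       - lie_form Z (form_app \<eta>) (lie_bracket X Y)
       = lie_two_form Z (ext_deriv D (form_app \<eta>)) X Y"
proof -
  note br = vector_fields_lie_bracket[OF A]
  have ed: "ext_deriv D (form_app \<eta>) V W
      = dir_deriv V (form_app \<eta> W) - dir_deriv W (form_app \<eta> V) - form_app \<eta> (lie_bracket V W)"
    if "V \<in> vector_fields A" "W \<in> vector_fields A" for V W
    using D form_app_diff[OF A \<eta>] that by (rule ext_deriv_torsion_free)
  note sm = dir_deriv_smooth[OF X] dir_deriv_smooth[OF Y] dir_deriv_smooth[OF Z]
    form_app_smooth[OF \<eta>] smooth_functions_diff[OF A]
  note dd = dir_deriv_diff[OF A X] dir_deriv_diff[OF A Y] dir_deriv_diff[OF A Z]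
  have jac: "form_app \<eta> (lie_bracket Z (lie_bracket X Y))
      = form_app \<eta> (lie_bracket (lie_bracket Z X) Y) + form_app \<eta> (lie_bracket X (lie_bracket Z Y))"
    by (simp add: lie_bracket_jacobi[OF A X Y Z] form_app_add[OF \<eta>] br X Y Z)
  show ?thesis
    by (simp add: lie_form_def lie_two_form_def ed jac br X Y Z dd sm dir_deriv_lie_bracket)
qed

section \<open>Almost contact metric structures with their Levi-Civita connection\<close>

locale almost_contact_levi_civita =
  fixes n :: nat
    and A :: "('m::{t2_space, second_countable_topology}, 'e::euclidean_space) atlas"
    and \<phi> :: "'m \<Rightarrow> 'm tvec \<Rightarrow> 'm tvec"
    and \<zeta> :: "'m vfield"
    and \<eta> :: "'m \<Rightarrow> 'm tvec \<Rightarrow> real"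
    and g :: "'m \<Rightarrow> 'm tvec \<Rightarrow> 'm tvec \<Rightarrow> real"
    and D :: "'m vfield \<Rightarrow> 'm vfield \<Rightarrow> 'm vfield"
  assumes contact: "almost_contact_metric_manifold n A \<phi> \<zeta> \<eta> g"
    and levi_civita: "levi_civita_connection A g D"
begin

abbreviation \<xi> where "\<xi> \<equiv> intrinsic_torsion D \<phi> \<zeta> \<eta>"
abbreviation D_U where "D_U \<equiv> minimal_connection D \<phi> \<zeta> \<eta>"
abbreviation D_\<eta> where "D_\<eta> X \<equiv> cov_form D X (form_app \<eta>)"

lemma atlas: "smooth_atlas A"
  and endo: "endo_field A \<phi>"
  and reeb: "\<zeta> \<in> vector_fields A"
  and form: "one_form A \<eta>"
  and metric: "riemannian_metric A g"
  and phi_phi: "v \<in> tangent_space A p \<Longrightarrow> \<phi> p (\<phi> p v) = - v + \<eta> p v *\<^sub>T \<zeta> p"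
  and eta_reeb: "\<eta> p (\<zeta> p) = 1"
  and metric_phi: "v \<in> tangent_space A p \<Longrightarrow> w \<in> tangent_space A p
    \<Longrightarrow> g p (\<phi> p v) (\<phi> p w) = g p v w - \<eta> p v * \<eta> p w"
  using contact by (auto simp: almost_contact_metric_manifold_def)

lemma connection: "affine_connection A D"
  and torsion_free: "X \<in> vector_fields A \<Longrightarrow> Y \<in> vector_fields A \<Longrightarrow> D X Y - D Y X = lie_bracket X Y"
  and metric_compatible: "X \<in> vector_fields A \<Longrightarrow> Y \<in> vector_fields A \<Longrightarrow> Z \<in> vector_fields A
    \<Longrightarrow> dir_deriv X (metric_app g Y Z) = metric_app g (D X Y) Z + metric_app g Y (D X Z)"
  using levi_civita by (auto simp: levi_civita_connection_def)

lemma D_vector_fields: "X \<in> vector_fields A \<Longrightarrow> Y \<in> vector_fields A \<Longrightarrow> D X Y \<in> vector_fields A"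
  and D_add_left: "X \<in> vector_fields A \<Longrightarrow> Y \<in> vector_fields A \<Longrightarrow> Z \<in> vector_fields A
    \<Longrightarrow> D (X + Y) Z = D X Z + D Y Z"
  and D_add_right: "X \<in> vector_fields A \<Longrightarrow> Y \<in> vector_fields A \<Longrightarrow> Z \<in> vector_fields A
    \<Longrightarrow> D X (Y + Z) = D X Y + D X Z"
  using connection by (auto simp: affine_connection_def)

lemma reeb_tangent: "\<zeta> p \<in> tangent_space A p"
  using reeb by (simp add: vector_fields_def)

lemma phi_tangent: "v \<in> tangent_space A p \<Longrightarrow> \<phi> p v \<in> tangent_space A p"
  and phi_add: "v \<in> tangent_space A p \<Longrightarrow> w \<in> tangent_space A p \<Longrightarrow> \<phi> p (v + w) = \<phi> p v + \<phi> p w"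
  and phi_scale: "v \<in> tangent_space A p \<Longrightarrow> \<phi> p (a *\<^sub>T v) = a *\<^sub>T \<phi> p v"
  using endo by (auto simp: endo_field_def)

lemma uminus_tvec_eq: "- v = (- 1) *\<^sub>T v" for v :: "'m tvec"
  by (simp add: scale_tvec_def fun_eq_iff)

lemma zero_tvec_eq: "(0 :: 'm tvec) = 0 *\<^sub>T v"
  by (simp add: scale_tvec_def fun_eq_iff)

lemma tangent_uminus: "v \<in> tangent_space A p \<Longrightarrow> - v \<in> tangent_space A p"
  by (simp add: uminus_tvec_eq scale_tvec_tangent)

lemma phi_zero: "\<phi> p 0 = 0"
  using phi_scale[OF reeb_tangent, of p 0] zero_tvec_eq by metis

lemma scale_reeb_eq_0: "a *\<^sub>T \<zeta> p = 0 \<Longrightarrow> a = 0"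
proof -
  assume a: "a *\<^sub>T \<zeta> p = 0"
  have "\<eta> p (c *\<^sub>T \<zeta> p) = c" for c
    using form reeb_tangent[of p] by (simp add: one_form_def eta_reeb)
  from this[of a] this[of 0] show "a = 0"
    by (simp add: a flip: zero_tvec_eq)
qed

text \<open>Computing \<open>\<phi>\<^sup>3 \<zeta>\<close> in two ways shows that \<open>\<phi> \<zeta> = a \<zeta>\<close> with \<open>a = \<eta>(\<phi> \<zeta>)\<close>; then
  \<open>0 = \<phi>\<^sup>2 \<zeta> = a\<^sup>2 \<zeta>\<close> forces \<open>a = 0\<close>.\<close>

lemma phi_reeb: "\<phi> p (\<zeta> p) = 0"
proof -
  let ?a = "\<eta> p (\<phi> p (\<zeta> p))"
  have 2: "\<phi> p (\<phi> p (\<zeta> p)) = 0"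
    by (simp add: phi_phi reeb_tangent eta_reeb scale_tvec_def fun_eq_iff)
  have "\<phi> p (\<phi> p (\<phi> p (\<zeta> p))) = - \<phi> p (\<zeta> p) + ?a *\<^sub>T \<zeta> p"
    by (rule phi_phi[OF phi_tangent[OF reeb_tangent]])
  then have 3: "\<phi> p (\<zeta> p) = ?a *\<^sub>T \<zeta> p" by (simp add: 2 phi_zero)
  then have "\<phi> p (\<phi> p (\<zeta> p)) = ?a *\<^sub>T (?a *\<^sub>T \<zeta> p)"
    using phi_scale[OF reeb_tangent] by metis
  then have "(?a * ?a) *\<^sub>T \<zeta> p = 0"
    using 2 by (simp add: scale_tvec_def mult.assoc)
  then have "?a = 0" using scale_reeb_eq_0 by fastforce
  then show ?thesis using 3 by (simp flip: zero_tvec_eq)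
qed

text \<open>Again by computing \<open>\<phi>\<^sup>3 v\<close> in two ways: \<open>\<phi>(\<phi>\<^sup>2 v)\<close> is \<open>- \<phi> v\<close>, whereas \<open>\<phi>\<^sup>2(\<phi> v)\<close> is
  \<open>- \<phi> v + \<eta>(\<phi> v) \<zeta>\<close>.\<close>

lemma eta_phi:
  assumes v: "v \<in> tangent_space A p" shows "\<eta> p (\<phi> p v) = 0"
proof -
  have "\<phi> p (\<phi> p (\<phi> p v)) = \<phi> p (- v + \<eta> p v *\<^sub>T \<zeta> p)"
    by (simp add: phi_phi v)
  also have "\<dots> = - \<phi> p v + \<eta> p v *\<^sub>T \<phi> p (\<zeta> p)"
    by (simp only: phi_add phi_scale tangent_uminus scale_tvec_tangent v reeb_tangent uminus_tvec_eq)
  also have "\<dots> = - \<phi> p v" by (simp add: phi_reeb scale_tvec_def fun_eq_iff)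
  finally have "\<eta> p (\<phi> p v) *\<^sub>T \<zeta> p = 0"
    using phi_phi[OF phi_tangent[OF v]] by simp
  then show ?thesis by (rule scale_reeb_eq_0)
qed

text \<open>This is the compatibility of \<open>g\<close> with \<open>\<phi>\<close> at \<open>\<zeta>\<close> and \<open>v\<close>, where \<open>\<phi> \<zeta> = 0\<close> removes the left side.\<close>

lemma metric_reeb:
  assumes v: "v \<in> tangent_space A p" shows "g p (\<zeta> p) v = \<eta> p v"
proof -
  have "g p (0 *\<^sub>T \<zeta> p) (\<phi> p v) = 0"
    using metric reeb_tangent[of p] phi_tangent[OF v] by (simp add: riemannian_metric_def)
  then show ?thesis
    using metric_phi[OF reeb_tangent v] by (simp add: phi_reeb eta_reeb flip: zero_tvec_eq)
qed

lemma metric_app_reeb: "Y \<in> vector_fields A \<Longrightarrow> metric_app g \<zeta> Y = form_app \<eta> Y"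
  by (simp add: metric_app_def form_app_def metric_reeb vector_fields_def)

lemma metric_app_sym:
  "X \<in> vector_fields A \<Longrightarrow> Y \<in> vector_fields A \<Longrightarrow> metric_app g X Y = metric_app g Y X"
  using metric by (simp add: metric_app_def riemannian_metric_def vector_fields_def fun_eq_iff)

lemma form_app_reeb: "form_app \<eta> \<zeta> = 1"
  by (simp add: form_app_def eta_reeb fun_eq_iff)

lemma D_\<eta>_metric:
  assumes "X \<in> vector_fields A" "Y \<in> vector_fields A"
  shows "D_\<eta> X Y = metric_app g (D X \<zeta>) Y"
  using metric_compatible[OF assms(1) reeb assms(2)] assms
  by (simp add: cov_form_def metric_app_reeb D_vector_fields algebra_simps)

text \<open>The value \<open>(D\<^sub>X \<eta>)(\<zeta>)\<close> is \<open>g(D\<^sub>X \<zeta>, \<zeta>) = \<eta>(D\<^sub>X \<zeta>)\<close>, but also \<open>X(\<eta>(\<zeta>)) - \<eta>(D\<^sub>X \<zeta>) = - \<eta>(D\<^sub>X \<zeta>)\<close>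
  because \<open>\<eta>(\<zeta>) = 1\<close> is constant.\<close>

lemma D_reeb_horizontal:
  assumes "X \<in> vector_fields A" shows "form_app \<eta> (D X \<zeta>) = 0"
proof -
  have D: "D X \<zeta> \<in> vector_fields A" by (rule D_vector_fields[OF assms reeb])
  have "metric_app g (D X \<zeta>) \<zeta> = form_app \<eta> (D X \<zeta>)"
    using metric_app_sym[OF D reeb] metric_app_reeb[OF D] by simp
  then have "D_\<eta> X \<zeta> = form_app \<eta> (D X \<zeta>)"
    by (simp add: D_\<eta>_metric[OF assms reeb])
  moreover have "D_\<eta> X \<zeta> = - form_app \<eta> (D X \<zeta>)"
    by (simp add: cov_form_def form_app_reeb dir_deriv_one[OF assms])
  ultimately show ?thesis by (simp add: fun_eq_iff)
qed

text \<open>Both sides are \<open>g(D\<^sub>X \<zeta>, D\<^sub>Y \<zeta>)\<close>.  This cancels the two terms that the final formula does not contain.\<close>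

lemma D_\<eta>_D_reeb_sym:
  assumes "X \<in> vector_fields A" "Y \<in> vector_fields A"
  shows "D_\<eta> X (D Y \<zeta>) = D_\<eta> Y (D X \<zeta>)"
  using assms by (simp add: D_\<eta>_metric D_vector_fields reeb metric_app_sym)

lemma D_\<eta>_smooth:
  "X \<in> vector_fields A \<Longrightarrow> Y \<in> vector_fields A \<Longrightarrow> D_\<eta> X Y \<in> smooth_functions A"
  by (simp add: cov_form_def smooth_functions_diff[OF atlas] dir_deriv_smooth form_app_smooth[OF form]
      D_vector_fields)

lemma D_\<eta>_add_left:
  "X \<in> vector_fields A \<Longrightarrow> Y \<in> vector_fields A \<Longrightarrow> Z \<in> vector_fields A
    \<Longrightarrow> D_\<eta> (X + Y) Z = D_\<eta> X Z + D_\<eta> Y Z"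
  by (simp add: cov_form_def D_add_left D_vector_fields form_app_add[OF form] dir_deriv_def
      fun_eq_iff)

lemma D_\<eta>_add_right:
  "X \<in> vector_fields A \<Longrightarrow> Y \<in> vector_fields A \<Longrightarrow> Z \<in> vector_fields A
    \<Longrightarrow> D_\<eta> X (Y + Z) = D_\<eta> X Y + D_\<eta> X Z"
  by (simp add: cov_form_def D_add_right D_vector_fields form_app_add[OF form]
      dir_deriv_add[of _ A] form_app_smooth[OF form])

lemma D_\<eta>_uminus_left:
  assumes "X \<in> vector_fields A" "Y \<in> vector_fields A"
  shows "D_\<eta> (- X) Y = - D_\<eta> X Y"
proof -
  have X': "- X \<in> vector_fields A" by (rule vector_fields_uminus[OF atlas assms(1)])
  have "D_\<eta> 0 Y = 0"
    using D_\<eta>_add_left[of 0 0 Y] vector_fields_add[OF atlas assms(1) X'] assms(2) by simp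
  then show ?thesis
    using D_\<eta>_add_left[OF assms(1) X' assms(2)] by (simp add: eq_neg_iff_add_eq_0 add.commute)
qed

text \<open>From \<open>\<phi> \<zeta> = 0\<close> one gets \<open>(D\<^sub>X \<phi>) \<zeta> = - \<phi> D\<^sub>X \<zeta>\<close>, and \<open>\<phi>\<^sup>2\<close> is \<open>- 1\<close> on the horizontal vector \<open>D\<^sub>X \<zeta>\<close>.
  The first and the last summand of \<open>\<xi>\<^sub>X \<zeta>\<close> therefore contribute \<open>- D\<^sub>X \<zeta> / 2\<close> each, and the middle one
  vanishes.\<close>

lemma torsion_reeb:
  assumes X: "X \<in> vector_fields A"
  shows "\<xi> X \<zeta> = - D X \<zeta>"
proof -
  have D: "D X \<zeta> \<in> vector_fields A" by (rule D_vector_fields[OF X reeb])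
  have p0: "endo_app \<phi> \<zeta> = 0" by (simp add: endo_app_def phi_reeb fun_eq_iff)
  have zv: "(0 :: 'm vfield) \<in> vector_fields A"
    using vector_fields_diff[OF atlas reeb reeb] by simp
  have D0: "D X 0 = 0"
    using D_add_right[OF X zv zv] by simp
  have eta0: "\<eta> p (D X \<zeta> p) = 0" for p
    using D_reeb_horizontal[OF X] by (simp add: form_app_def fun_eq_iff)
  have tD: "D X \<zeta> p \<in> tangent_space A p" for p using D by (simp add: vector_fields_def)
  have "\<phi> p (cov_endo D X (endo_app \<phi>) \<zeta> p) = D X \<zeta> p" for p
  proof -
    have "cov_endo D X (endo_app \<phi>) \<zeta> p = (- 1) *\<^sub>T \<phi> p (D X \<zeta> p)"
      by (simp add: cov_endo_def p0 D0 flip: uminus_tvec_eq) (simp add: endo_app_def)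
    then have "\<phi> p (cov_endo D X (endo_app \<phi>) \<zeta> p) = (- 1) *\<^sub>T \<phi> p (\<phi> p (D X \<zeta> p))"
      using phi_scale[OF phi_tangent[OF tD]] by simp
    then show ?thesis by (simp add: phi_phi[OF tD] eta0 scale_tvec_def fun_eq_iff)
  qed
  then have "endo_app \<phi> (cov_endo D X (endo_app \<phi>) \<zeta>) = D X \<zeta>"
    by (simp add: endo_app_def fun_eq_iff)
  moreover have "D_\<eta> X \<zeta> = 0"
    by (simp add: cov_form_def form_app_reeb dir_deriv_one[OF X] D_reeb_horizontal[OF X])
  ultimately show ?thesis
    by (simp add: intrinsic_torsion_def form_app_reeb scale_vfield_def scale_tvec_def fun_eq_iff)
qed

lemma cov_endo_vector_fields:
  "X \<in> vector_fields A \<Longrightarrow> Y \<in> vector_fields A \<Longrightarrow> cov_endo D X (endo_app \<phi>) Y \<in> vector_fields A"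
  using endo by (auto simp: cov_endo_def endo_field_def intro!: vector_fields_diff[OF atlas]
      D_vector_fields)

lemma phi_vector_fields: "X \<in> vector_fields A \<Longrightarrow> endo_app \<phi> X \<in> vector_fields A"
  using endo by (simp add: endo_field_def)

lemmas vf_intros = vector_fields_add[OF atlas] vector_fields_diff[OF atlas]
  vector_fields_uminus[OF atlas] vector_fields_scale[OF atlas smooth_functions_const]
  vector_fields_scale[OF atlas D_\<eta>_smooth] vector_fields_scale[OF atlas form_app_smooth[OF form]]
  phi_vector_fields cov_endo_vector_fields reeb D_vector_fields

lemma torsion_vector_fields:
  "X \<in> vector_fields A \<Longrightarrow> Y \<in> vector_fields A \<Longrightarrow> \<xi> X Y \<in> vector_fields A"
  unfolding intrinsic_torsion_def by (intro vf_intros)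

text \<open>The first summand of \<open>\<xi>\<^sub>X Y\<close> lies in the image of \<open>\<phi>\<close> and the last is a multiple of \<open>D\<^sub>X \<zeta>\<close>, so \<open>\<eta>\<close>
  kills both and sees only the component along \<open>\<zeta>\<close>.\<close>

lemma eta_torsion:
  assumes "X \<in> vector_fields A" "Y \<in> vector_fields A"
  shows "form_app \<eta> (\<xi> X Y) = D_\<eta> X Y"
proof -
  let ?C = "cov_endo D X (endo_app \<phi>) Y"
  have C: "?C \<in> vector_fields A" using assms by (rule cov_endo_vector_fields)
  have "form_app \<eta> (endo_app \<phi> ?C) = 0"
    using C by (simp add: form_app_def endo_app_def vector_fields_def eta_phi fun_eq_iff)
  then show ?thesis
    using assms
    by (simp add: intrinsic_torsion_def form_app_add[OF form] form_app_diff[OF atlas form]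
        form_app_uminus[OF form] form_app_scale[OF form] vf_intros form_app_reeb D_reeb_horizontal)
qed

lemma minimal_connection_vector_fields:
  "X \<in> vector_fields A \<Longrightarrow> Y \<in> vector_fields A \<Longrightarrow> D_U X Y \<in> vector_fields A"
  by (simp add: minimal_connection_def vf_intros torsion_vector_fields)

text \<open>This says that \<open>\<eta>\<close> is parallel for the minimal connection.\<close>

lemma eta_minimal_connection:
  assumes "X \<in> vector_fields A" "Y \<in> vector_fields A"
  shows "form_app \<eta> (D_U X Y) = dir_deriv X (form_app \<eta> Y)"
proof -
  have "form_app \<eta> (D_U X Y) = form_app \<eta> (D X Y) + D_\<eta> X Y"
    using assms by (simp add: minimal_connection_def form_app_add[OF form] torsion_vector_fields
        D_vector_fields eta_torsion)
  then show ?thesis by (simp add: cov_form_def)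
qed

text \<open>The term added to the bracket is the difference between differentiating along \<open>\<zeta>\<close> with the
  minimal connection and with the Lie derivative.\<close>

lemma minimal_connection_reeb_bracket:
  assumes "X \<in> vector_fields A"
  shows "D_U \<zeta> X = lie_bracket \<zeta> X + (D X \<zeta> + \<xi> \<zeta> X)"
  using torsion_free[OF reeb assms] by (simp add: minimal_connection_def algebra_simps)

text \<open>The two derivatives differ by \<open>\<eta>(D\<^sub>Y \<zeta>)\<close>, which vanishes.\<close>

lemma D_\<eta>_reeb_lie:
  assumes "Y \<in> vector_fields A"
  shows "D_\<eta> \<zeta> Y = lie_form \<zeta> (form_app \<eta>) Y"
proof -
  have "form_app \<eta> (lie_bracket \<zeta> Y) = form_app \<eta> (D \<zeta> Y) - form_app \<eta> (D Y \<zeta>)"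
    using assms by (simp add: form_app_diff[OF atlas form] D_vector_fields reeb
        flip: torsion_free[OF reeb assms])
  then show ?thesis by (simp add: cov_form_def lie_form_def D_reeb_horizontal assms)
qed

lemma reeb_torsion_form:
  "Y \<in> vector_fields A \<Longrightarrow> endo_act (\<xi> \<zeta>) (form_app \<eta>) Y = - lie_form \<zeta> (form_app \<eta>) Y"
  by (simp add: endo_act_def eta_torsion reeb D_\<eta>_reeb_lie)

lemma ext_deriv_reeb_torsion_form:
  assumes X: "X \<in> vector_fields A" and Y: "Y \<in> vector_fields A"
  shows "ext_deriv D (endo_act (\<xi> \<zeta>) (form_app \<eta>)) X Y
       = - lie_two_form \<zeta> (ext_deriv D (form_app \<eta>)) X Y"
proof -
  let ?\<alpha> = "endo_act (\<xi> \<zeta>) (form_app \<eta>)" and ?L = "lie_form \<zeta> (form_app \<eta>)"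
  have add: "D_\<eta> \<zeta> (V - W) = D_\<eta> \<zeta> V - D_\<eta> \<zeta> W"
    if "V \<in> vector_fields A" "W \<in> vector_fields A" for V W
    using D_\<eta>_add_right[OF reeb _ that(2), of "V - W"] that by (simp add: vf_intros)
  have sub: "?\<alpha> (V - W) = ?\<alpha> V - ?\<alpha> W"
    if "V \<in> vector_fields A" "W \<in> vector_fields A" for V W
    using that add[OF that] by (simp add: endo_act_def eta_torsion reeb vf_intros)
  have L: "?L V \<in> smooth_functions A" if "V \<in> vector_fields A" for V
    using D_\<eta>_smooth[OF reeb that] D_\<eta>_reeb_lie[OF that] by simp
  have neg: "dir_deriv V (- ?L W) = - dir_deriv V (?L W)"
    if "V \<in> vector_fields A" "W \<in> vector_fields A" for V W
    using dir_deriv_cmult[OF that(1) L[OF that(2)], of "- 1"] by (simp add: fun_Compl_def)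
  have "ext_deriv D ?\<alpha> X Y
      = dir_deriv X (?\<alpha> Y) - dir_deriv Y (?\<alpha> X) - ?\<alpha> (lie_bracket X Y)"
    using connection torsion_free sub X Y by (rule ext_deriv_torsion_free)
  also have "\<dots> = - (dir_deriv X (?L Y) - dir_deriv Y (?L X) - ?L (lie_bracket X Y))"
    by (simp add: reeb_torsion_form X Y vector_fields_lie_bracket[OF atlas] neg)
  also have "\<dots> = - lie_two_form \<zeta> (ext_deriv D (form_app \<eta>)) X Y"
    using lie_form_ext_deriv_commute[OF atlas form X Y reeb connection torsion_free] by simp
  finally show ?thesis .
qed

text \<open>Because \<open>\<eta>\<close> is parallel for \<open>U\<close>, it passes through the outer derivative in
  \<open>U\<^sub>\<zeta>(\<xi>\<^sub>X Y)\<close>, which leaves only covariant derivatives of \<open>\<eta>\<close>.\<close>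

lemma endo_act_cov_torsion:
  assumes X: "X \<in> vector_fields A" and Y: "Y \<in> vector_fields A"
  shows "endo_act (cov_endo_form D_U \<zeta> \<xi> X) (form_app \<eta>) Y
       = - dir_deriv \<zeta> (D_\<eta> X Y) + D_\<eta> (D_U \<zeta> X) Y + D_\<eta> X (D_U \<zeta> Y)"
  using assms by (simp add: endo_act_def cov_endo_form_def form_app_diff[OF atlas form] vf_intros
      torsion_vector_fields minimal_connection_vector_fields eta_minimal_connection eta_torsion)

lemma ext_deriv_reeb_torsion:
  assumes X: "X \<in> vector_fields A" and Y: "Y \<in> vector_fields A"
  shows "ext_deriv D (endo_act (\<xi> \<zeta>) (form_app \<eta>)) X Y =
      endo_act (cov_endo_form D_U \<zeta> \<xi> X) (form_app \<eta>) Y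
    - endo_act (cov_endo_form D_U \<zeta> \<xi> Y) (form_app \<eta>) X
    + endo_act (\<xi> X) (form_app \<eta>) (\<xi> \<zeta> Y) - endo_act (\<xi> Y) (form_app \<eta>) (\<xi> \<zeta> X)
    - endo_act (\<xi> (\<xi> X \<zeta>)) (form_app \<eta>) Y + endo_act (\<xi> (\<xi> Y \<zeta>)) (form_app \<eta>) X
    + endo_act (\<xi> (\<xi> \<zeta> X)) (form_app \<eta>) Y - endo_act (\<xi> (\<xi> \<zeta> Y)) (form_app \<eta>) X"
proof -
  note vf = X Y reeb torsion_vector_fields D_vector_fields vector_fields_lie_bracket[OF atlas]
    vf_intros
  have act: "endo_act (\<xi> V) (form_app \<eta>) W = - D_\<eta> V W"
    if "V \<in> vector_fields A" "W \<in> vector_fields A" for V W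
    using that by (simp add: endo_act_def eta_torsion)
  have dd: "dir_deriv \<zeta> (D_\<eta> X Y - D_\<eta> Y X) = dir_deriv \<zeta> (D_\<eta> X Y) - dir_deriv \<zeta> (D_\<eta> Y X)"
    by (intro dir_deriv_diff[OF atlas] D_\<eta>_smooth reeb X Y)
  \<comment> \<open>Once everything is expressed through \<open>(D\<^sub>V \<eta>)(W)\<close>, bilinearity and the symmetry of
    \<open>(D\<^sub>X \<eta>)(D\<^sub>Y \<zeta>)\<close> suffice; instantiating the symmetry keeps the rewriting from looping.\<close>
  show ?thesis
    unfolding ext_deriv_reeb_torsion_form[OF X Y] lie_two_form_def
    by (simp add: ext_deriv_def[of D "form_app \<eta>"] dd act endo_act_cov_torsion vf torsion_reeb
        minimal_connection_reeb_bracket D_\<eta>_add_left D_\<eta>_add_right D_\<eta>_uminus_left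
        D_\<eta>_D_reeb_sym[OF Y X] algebra_simps)
qed

end

theorem proposition3p8:
  fixes n :: nat
    and A :: "('m::{t2_space, second_countable_topology}, 'e::euclidean_space) atlas"
    and \<phi> :: "'m \<Rightarrow> 'm tvec \<Rightarrow> 'm tvec"
    and \<zeta> :: "'m vfield"
    and \<eta> :: "'m \<Rightarrow> 'm tvec \<Rightarrow> real"
    and g :: "'m \<Rightarrow> 'm tvec \<Rightarrow> 'm tvec \<Rightarrow> real"
    and nabla nablaU \<xi> :: "'m vfield \<Rightarrow> 'm vfield \<Rightarrow> 'm vfield"
    and \<eta>' :: "'m vfield \<Rightarrow> 'm \<Rightarrow> real"
    and X Y :: "'m vfield"
  assumes "almost_contact_metric_manifold n A \<phi> \<zeta> \<eta> g"
    and "levi_civita_connection A g nabla"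
    and "\<xi> = intrinsic_torsion nabla \<phi> \<zeta> \<eta>"
    and "nablaU = minimal_connection nabla \<phi> \<zeta> \<eta>"
    and "\<eta>' = form_app \<eta>"
    and "X \<in> vector_fields A" and "Y \<in> vector_fields A"
  shows "ext_deriv nabla (endo_act (\<xi> \<zeta>) \<eta>') X Y =
      endo_act (cov_endo_form nablaU \<zeta> \<xi> X) \<eta>' Y - endo_act (cov_endo_form nablaU \<zeta> \<xi> Y) \<eta>' X
    + endo_act (\<xi> X) \<eta>' (\<xi> \<zeta> Y) - endo_act (\<xi> Y) \<eta>' (\<xi> \<zeta> X)
    - endo_act (\<xi> (\<xi> X \<zeta>)) \<eta>' Y + endo_act (\<xi> (\<xi> Y \<zeta>)) \<eta>' X
    + endo_act (\<xi> (\<xi> \<zeta> X)) \<eta>' Y - endo_act (\<xi> (\<xi> \<zeta> Y)) \<eta>' X"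
proof -
  interpret almost_contact_levi_civita n A \<phi> \<zeta> \<eta> g nabla
    using assms(1,2) by unfold_locales
  show ?thesis
    unfolding assms(3-5) using assms(6,7) by (rule ext_deriv_reeb_torsion)
qed

end
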